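(* A function $f:\mathcal{S}^{2\times 2}\to\mathbb{R}$ is symmetric polyconvex if and only if there exists a convex function $g:\mathcal{S}^{2\times 2}\times \mathbb{R}\to \mathbb{R}$ that is non-increasing with respect to the second variable such that $$f(\varepsilon) = g(\varepsilon, \det \varepsilon) \quad \text{for all } \varepsilon\in \mathcal{S}^{2\times 2}.$$
   Context: $\mathcal{S}^{2\times 2}$ denotes the space of symmetric matrices in $\mathbb{R}^{2\times 2}$, and $F^s=\frac12(F+F^T)$ for $F\in\mathbb{R}^{2\times 2}$. A function $\tilde f:\mathbb{R}^{2\times 2}\to\mathbb{R}$ is polyconvex if there is a convex function $G:\mathbb{R}^{2\times 2}\times\mathbb{R}\to\mathbb{R}$ with $\tilde f(F)=G(F,\det F)$ for all $F\in\mathbb{R}^{2\times 2}$. A function $f:\mathcal{S}^{2\times 2}\to\mathbb{R}$ is symmetric polyconvex if the function $\tilde f:\mathbb{R}^{2\times 2}\to\mathbb{R}$, $\tilde f(F)=f(F^s)$, is polyconvex. *)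

theory Defs
  imports "HOL-Analysis.Analysis"
begin

definition sym_mats :: "(real ^ 2 ^ 2) set" where
  "sym_mats = {A. transpose A = A}"

definition sym_part :: "real ^ 2 ^ 2 \<Rightarrow> real ^ 2 ^ 2" where
  "sym_part F = (1 / 2) *\<^sub>R (F + transpose F)"

definition polyconvex :: "(real ^ 2 ^ 2 \<Rightarrow> real) \<Rightarrow> bool" where
  "polyconvex h \<longleftrightarrow>
     (\<exists>G :: (real ^ 2 ^ 2) \<times> real \<Rightarrow> real. convex_on UNIV G \<and> (\<forall>F. h F = G (F, det F)))"

(* A function on the symmetric matrices is represented by a total function on all matrices,
   of which only the values on sym_mats matter (see sym_polyconvex_cong). *)
definition sym_polyconvex :: "(real ^ 2 ^ 2 \<Rightarrow> real) \<Rightarrow> bool" where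
  "sym_polyconvex f \<longleftrightarrow> polyconvex (\<lambda>F. f (sym_part F))"

lemma sym_part_in_sym_mats: "sym_part F \<in> sym_mats"
  by (simp add: sym_part_def sym_mats_def transpose_def vec_eq_iff add.commute)

lemma sym_polyconvex_cong:
  assumes "\<And>A. A \<in> sym_mats \<Longrightarrow> f A = f' A"
  shows "sym_polyconvex f \<longleftrightarrow> sym_polyconvex f'"
  using assms by (simp add: sym_polyconvex_def sym_part_in_sym_mats)

end

theory Submission
  imports Defs
begin

text \<open>
  In dimension two a matrix \<open>F\<close> is its symmetric part plus \<open>\<omega>\<close> times the rotation by a right
  angle, and \<open>det F = det (sym_part F) + \<omega>\<^sup>2\<close> (lemma \<open>det_eq_det_sym_part\<close>). Both directions of
  the theorem rest on this identity.

  If \<open>f \<epsilon> = g (\<epsilon>, det \<epsilon>)\<close> with \<open>g\<close> convex and non-increasing in its second argument, then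
  \<open>f (sym_part F) = g (sym_part F, det F - \<omega>\<^sup>2)\<close>. Since \<open>t - \<omega>\<^sup>2\<close> is concave in \<open>(F, t)\<close>, the
  function \<open>G (F, t) = g (sym_part F, t - \<omega>\<^sup>2)\<close> is convex.

  If \<open>f (sym_part F) = G (F, det F)\<close> with \<open>G\<close> convex, then the restriction of \<open>G\<close> itself
  serves as \<open>g\<close>. Only its monotonicity is at stake. The matrices with symmetric
  part \<open>\<epsilon>\<close> and skew parts \<open>\<omega>\<close> and \<open>-\<omega>\<close> have the same determinant \<open>det \<epsilon> + \<omega>\<^sup>2\<close> and the
  midpoint \<open>\<epsilon>\<close>, so convexity gives \<open>G (\<epsilon>, det \<epsilon> + \<omega>\<^sup>2) \<le> f \<epsilon>\<close>. Hence \<open>G (\<epsilon>, t)\<close> is bounded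
  above for large \<open>t\<close>, and a convex function on the line with this property is non-increasing
  (lemma \<open>convex_bdd_above_at_top_imp_antimono\<close>).
\<close>

definition skew_coeff :: "real ^ 2 ^ 2 \<Rightarrow> real" where
  "skew_coeff F = (F $ 1 $ 2 - F $ 2 $ 1) / 2"

definition skew_mat :: "real \<Rightarrow> real ^ 2 ^ 2" where
  "skew_mat w = vector [vector [0, w], vector [- w, 0]]"

lemma linear_skew_coeff: "linear skew_coeff"
  by (rule linearI) (simp_all add: skew_coeff_def field_simps)

lemma linear_sym_part: "linear sym_part"
  by (rule linearI) (simp_all add: sym_part_def transpose_def vec_eq_iff algebra_simps)

text \<open>
  The determinant is a quadratic form for which symmetric and skew matrices are orthogonal.
\<close>

lemma det_eq_det_sym_part: "det F = det (sym_part F) + (skew_coeff F)\<^sup>2"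
  by (simp add: det_2 sym_part_def skew_coeff_def transpose_def power2_eq_square field_simps)

lemma sym_part_of_sym: "A \<in> sym_mats \<Longrightarrow> sym_part A = A"
  by (simp add: sym_part_def sym_mats_def)

lemma sym_mats_iff: "A \<in> sym_mats \<longleftrightarrow> A $ 1 $ 2 = A $ 2 $ 1"
  by (auto simp: sym_mats_def transpose_def vec_eq_iff forall_2)

lemma sym_part_add_skew_mat:
  assumes "A \<in> sym_mats"
  shows "sym_part (A + skew_mat w) = A"
proof -
  have "sym_part (skew_mat w) = 0"
    by (simp add: sym_part_def skew_mat_def transpose_def vec_eq_iff forall_2)
  then show ?thesis
    by (simp add: linear_add[OF linear_sym_part] sym_part_of_sym[OF assms])
qed

lemma det_add_skew_mat:
  assumes "A \<in> sym_mats"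
  shows "det (A + skew_mat w) = det A + w\<^sup>2"
proof -
  have "skew_coeff (A + skew_mat w) = w"
    using assms by (simp add: sym_mats_iff skew_coeff_def skew_mat_def)
  then show ?thesis
    using det_eq_det_sym_part[of "A + skew_mat w"] sym_part_add_skew_mat[OF assms] by simp
qed

lemma convex_sym_mats: "convex sym_mats"
  by (auto simp: convex_def sym_mats_iff)

text \<open>
  If \<open>h x < h y\<close> for some \<open>x < y\<close>, convexity keeps \<open>h\<close> above the line through these two points
  to the right of \<open>y\<close>, and that line is unbounded.
\<close>

lemma convex_bdd_above_at_top_imp_antimono:
  fixes h :: "real \<Rightarrow> real"
  assumes conv: "convex_on UNIV h" and bdd: "\<And>t. t \<ge> a \<Longrightarrow> h t \<le> M"
  shows "antimono h"
proof (rule antimonoI, rule ccontr)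
  fix x y :: real
  assume "x \<le> y" and less: "\<not> h y \<le> h x"
  then have xy: "x < y"
    by (cases "x = y") auto
  define d where "d = h y - h x"
  have d: "d > 0"
    using less by (simp add: d_def)
  \<comment> \<open>Large enough that the point \<open>x + n * (y - x)\<close> lies beyond \<open>a\<close> and the secant value
      \<open>h x + n * d\<close> exceeds \<open>M\<close>.\<close>
  define n where "n = max 1 (max ((a - x) / (y - x)) ((M - h x) / d + 1))"
  have n1: "n \<ge> 1" and na: "n \<ge> (a - x) / (y - x)" and nM: "n \<ge> (M - h x) / d + 1"
    by (simp_all add: n_def)
  define z where "z = x + n * (y - x)"
  have "z \<ge> a"
    using na xy by (simp add: z_def field_simps)
  then have "h z \<le> M"
    by (rule bdd)
  have "y = (1 - 1 / n) *\<^sub>R x + (1 / n) *\<^sub>R z"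
    using n1 by (simp add: z_def field_simps)
  then have "h y \<le> (1 - 1 / n) * h x + (1 / n) * h z"
    using convex_onD[OF conv, of "1 / n" x z] n1 by simp
  then have "n * h y \<le> n * ((1 - 1 / n) * h x + (1 / n) * h z)"
    using n1 by (intro mult_left_mono) auto
  also have "\<dots> = (n - 1) * h x + h z"
    using n1 by (simp add: field_simps)
  finally have "n * d \<le> h z - h x"
    by (simp add: d_def algebra_simps)
  moreover have "n * d \<ge> M - h x + d"
    using mult_right_mono[OF nM, of d] d by (simp add: distrib_right)
  ultimately show False
    using \<open>h z \<le> M\<close> d by linarith
qed

text \<open>
  For \<open>t \<ge> det A\<close> the two matrices \<open>A \<plusminus> skew_mat w\<close> with \<open>w\<^sup>2 = t - det A\<close> have determinant \<open>t\<close>,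
  so \<open>G\<close> takes the value \<open>f A\<close> at both. Convexity at their midpoint bounds \<open>G (A, t)\<close> by \<open>f A\<close>,
  uniformly in \<open>t\<close>.
\<close>

lemma antimono_of_polyconvex_representation:
  fixes f :: "real ^ 2 ^ 2 \<Rightarrow> real"
  assumes conv: "convex_on UNIV G" and G: "\<And>F. f (sym_part F) = G (F, det F)"
    and A: "A \<in> sym_mats"
  shows "antimono (\<lambda>t. G (A, t))"
proof (rule convex_bdd_above_at_top_imp_antimono)
  show "convex_on UNIV (\<lambda>t. G (A, t))"
  proof (rule convex_onI)
    fix t x y :: real
    assume "0 < t" "t < 1"
    moreover have "(1 - t) *\<^sub>R (A, x) + t *\<^sub>R (A, y) = (A, (1 - t) *\<^sub>R x + t *\<^sub>R y)"
      by (simp add: algebra_simps)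
    ultimately show "G (A, (1 - t) *\<^sub>R x + t *\<^sub>R y) \<le> (1 - t) * G (A, x) + t * G (A, y)"
      using convex_onD[OF conv, of t "(A, x)" "(A, y)"] by simp
  qed simp
next
  fix t assume t: "det A \<le> t"
  define w where "w = sqrt (t - det A)"
  have value_on_fibre: "G (A + skew_mat v, t) = f A" if "v\<^sup>2 = t - det A" for v
    using G[of "A + skew_mat v"] that
    by (simp add: sym_part_add_skew_mat[OF A] det_add_skew_mat[OF A])
  have "(1 - 1 / 2) *\<^sub>R (A + skew_mat w, t) + (1 / 2 :: real) *\<^sub>R (A + skew_mat (- w), t) = (A, t)"
    by (simp add: skew_mat_def vec_eq_iff forall_2 field_simps)
  then have "G (A, t) \<le> (1 - 1 / 2) * G (A + skew_mat w, t) + 1 / 2 * G (A + skew_mat (- w), t)"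
    using convex_onD[OF conv, of "1 / 2" "(A + skew_mat w, t)" "(A + skew_mat (- w), t)"] by simp
  also have "\<dots> = f A"
    using t by (simp add: value_on_fibre w_def)
  finally show "G (A, t) \<le> f A" .
qed

text \<open>
  This is the rule that a convex function, non-increasing in one argument, stays convex when a
  concave function is substituted for that argument.
\<close>

lemma convex_on_of_antimono_representation:
  fixes g :: "(real ^ 2 ^ 2) \<times> real \<Rightarrow> real"
  assumes conv: "convex_on (sym_mats \<times> UNIV) g"
    and anti: "\<And>A. A \<in> sym_mats \<Longrightarrow> antimono (\<lambda>t. g (A, t))"
  shows "convex_on UNIV (\<lambda>(F, t). g (sym_part F, t - (skew_coeff F)\<^sup>2))"
proof (rule convex_onI)
  fix u :: real and p q :: "(real ^ 2 ^ 2) \<times> real"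
  assume u: "0 < u" "u < 1"
  obtain E s F t where pq: "p = (E, s)" "q = (F, t)"
    by (cases p, cases q)
  let ?C = "(1 - u) *\<^sub>R E + u *\<^sub>R F"
  have skew: "skew_coeff ?C = (1 - u) * skew_coeff E + u * skew_coeff F"
    by (simp add: linear_add[OF linear_skew_coeff] linear_scale[OF linear_skew_coeff])
  have "(skew_coeff ?C)\<^sup>2 \<le> (1 - u) * (skew_coeff E)\<^sup>2 + u * (skew_coeff F)\<^sup>2"
    using convex_onD[OF convex_power2, of u "skew_coeff E" "skew_coeff F"] u skew by simp
  then have le: "(1 - u) * (s - (skew_coeff E)\<^sup>2) + u * (t - (skew_coeff F)\<^sup>2)
      \<le> (1 - u) * s + u * t - (skew_coeff ?C)\<^sup>2"
    by (simp add: algebra_simps)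
  have "g (sym_part ?C, (1 - u) * s + u * t - (skew_coeff ?C)\<^sup>2)
      \<le> g (sym_part ?C, (1 - u) * (s - (skew_coeff E)\<^sup>2) + u * (t - (skew_coeff F)\<^sup>2))"
    using antimonoD[OF anti[OF sym_part_in_sym_mats] le] .
  also have "\<dots> = g ((1 - u) *\<^sub>R (sym_part E, s - (skew_coeff E)\<^sup>2)
      + u *\<^sub>R (sym_part F, t - (skew_coeff F)\<^sup>2))"
    by (simp add: linear_add[OF linear_sym_part] linear_scale[OF linear_sym_part])
  also have "\<dots> \<le> (1 - u) * g (sym_part E, s - (skew_coeff E)\<^sup>2)
      + u * g (sym_part F, t - (skew_coeff F)\<^sup>2)"
    using u by (intro convex_onD[OF conv]) (auto simp: sym_part_in_sym_mats)
  finally show "(case (1 - u) *\<^sub>R p + u *\<^sub>R q of (F, t) \<Rightarrow> g (sym_part F, t - (skew_coeff F)\<^sup>2))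
      \<le> (1 - u) * (case p of (F, t) \<Rightarrow> g (sym_part F, t - (skew_coeff F)\<^sup>2))
        + u * (case q of (F, t) \<Rightarrow> g (sym_part F, t - (skew_coeff F)\<^sup>2))"
    by (simp add: pq)
qed simp

theorem theorem4p1:
  fixes f :: "real ^ 2 ^ 2 \<Rightarrow> real"
  shows "sym_polyconvex f \<longleftrightarrow>
    (\<exists>g :: (real ^ 2 ^ 2) \<times> real \<Rightarrow> real.
       convex_on (sym_mats \<times> UNIV) g \<and>
       (\<forall>\<epsilon>\<in>sym_mats. antimono (\<lambda>t. g (\<epsilon>, t))) \<and>
       (\<forall>\<epsilon>\<in>sym_mats. f \<epsilon> = g (\<epsilon>, det \<epsilon>)))"
proof
  assume "sym_polyconvex f"
  then obtain G where conv: "convex_on UNIV G" and G: "\<And>F. f (sym_part F) = G (F, det F)"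
    by (auto simp: sym_polyconvex_def polyconvex_def)
  have "convex_on (sym_mats \<times> UNIV) G"
    by (rule convex_on_subset[OF conv]) (simp_all add: convex_Times convex_sym_mats)
  moreover have "\<forall>A\<in>sym_mats. antimono (\<lambda>t. G (A, t))"
    using antimono_of_polyconvex_representation[OF conv G] by blast
  moreover have "\<forall>A\<in>sym_mats. f A = G (A, det A)"
    by (metis G sym_part_of_sym)
  ultimately show "\<exists>g :: (real ^ 2 ^ 2) \<times> real \<Rightarrow> real.
       convex_on (sym_mats \<times> UNIV) g \<and>
       (\<forall>\<epsilon>\<in>sym_mats. antimono (\<lambda>t. g (\<epsilon>, t))) \<and>
       (\<forall>\<epsilon>\<in>sym_mats. f \<epsilon> = g (\<epsilon>, det \<epsilon>))"
    by blast
next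
  assume "\<exists>g :: (real ^ 2 ^ 2) \<times> real \<Rightarrow> real.
       convex_on (sym_mats \<times> UNIV) g \<and>
       (\<forall>\<epsilon>\<in>sym_mats. antimono (\<lambda>t. g (\<epsilon>, t))) \<and>
       (\<forall>\<epsilon>\<in>sym_mats. f \<epsilon> = g (\<epsilon>, det \<epsilon>))"
  then obtain g :: "(real ^ 2 ^ 2) \<times> real \<Rightarrow> real"
    where conv: "convex_on (sym_mats \<times> UNIV) g"
      and anti: "\<And>A. A \<in> sym_mats \<Longrightarrow> antimono (\<lambda>t. g (A, t))"
      and f: "\<And>A. A \<in> sym_mats \<Longrightarrow> f A = g (A, det A)"
    by blast
  have "f (sym_part F) = g (sym_part F, det F - (skew_coeff F)\<^sup>2)" for F
    using f[OF sym_part_in_sym_mats] det_eq_det_sym_part[of F] by simp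
  then show "sym_polyconvex f"
    unfolding sym_polyconvex_def polyconvex_def
    using convex_on_of_antimono_representation[OF conv anti]
    by (intro exI[of _ "\<lambda>(F, t). g (sym_part F, t - (skew_coeff F)\<^sup>2)"]) simp
qed

end
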